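(* Let $X$ be a quasi-Banach space over $\mathbb{K}$ ($\mathbb{K}=\mathbb{R}$ or $\mathbb{C}$), let $(Y_{nm})_{(n,m)\in\mathbb{N}^2}$ be a double-sequence of quasi-normed spaces, and let $(T_{nm}:X\to Y_{nm})_{(n,m)\in\mathbb{N}^2}$ be a double-sequence of bounded homogenous (not necessarily linear) operators satisfying $$\sup_{n\in\mathbb{N}}\|T_{nm}\|=\infty\quad\text{for all } m\in\mathbb{N}.$$ Suppose further that there are two sequences $(C_m)_{m\in\mathbb{N}}$ and $(L_m)_{m\in\mathbb{N}}$ of positive real numbers, a sequence $(N_m)_{m\in\mathbb{N}}$ in $\mathbb{N}$, and two double-sequences $(c_{nm})_{(n,m)\in\mathbb{N}^2}$ and $(f_{nm})_{(n,m)\in\mathbb{N}^2}$ of functions from $X$ into $[0,\infty)$ such that: (i) for every $x\in X$, each $y\in X$ with $\|y\|\leq 1$ and all $n,m\in\mathbb{N}$ with $n\geq N_m$, $$\|T_{nm}(x+y)\|\leq C_m\left(\|T_{nm}x\|+\|T_{nm}\|\,\|y\|+f_{nm}(x)\right);$$ (ii) for every $x\in X$, $f_{nm}(x)=O(1)$ as $n\to\infty$ uniformly in $m\in\mathbb{N}$ (that is, for every $x\in X$ there are $M\geq 0$ and $n_0\in\mathbb{N}$ such that $f_{nm}(x)\leq M$ for all $n\geq n_0$ and all $m\in\mathbb{N}$); (iii) for every $x\in X$, each $y\in X$ with $\|y\|\leq 1$ and all $n,m\in\mathbb{N}$, $$\|T_{nm}y\|\leq L_m\left(\|T_{nm}(x+y)\|+\|T_{nm}x\|+c_{nm}(x)\|T_{nm}\|\right);$$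 (iv) for every $x\in X$ and every $m\in\mathbb{N}$, $c_{nm}(x)\to 0$ as $n\to\infty$. Then there is an element $x\in X$ such that $$\sup_{n\in\mathbb{N}}\|T_{nm}x\|=\infty\quad\text{for all } m\in\mathbb{N}.$$
   Context: A quasi-norm on a linear space $X$ over $\mathbb{K}=\mathbb{R}$ or $\mathbb{C}$ is a map $\|\cdot\|:X\to[0,\infty)$ such that $\|x\|=0$ implies $x=0$; $\|\lambda x\|=|\lambda|\|x\|$ for all $x\in X$, $\lambda\in\mathbb{K}$; and there is a constant $K\geq 1$ with $\|x+y\|\leq K(\|x\|+\|y\|)$ for all $x,y\in X$. The pair $(X,\|\cdot\|)$ is then called a quasi-normed space. The topology $\tau$ induced by a quasi-norm: a set $O\subseteq X$ is open if for every $x\in O$ there is $\varepsilon>0$ with $\{y\in X:\|x-y\|<\varepsilon\}\subseteq O$. With this topology $X$ is a (metrizable) topological vector space, and $(X,\|\cdot\|)$ is called a quasi-Banach space if $(X,\tau)$ is complete (equivalently, $X$ is complete with respect to some, or any, translation-invariant metric inducing $\tau$). A map $T:X\to Y$ between quasi-normed spaces (both quasi-norms are denoted $\|\cdot\|$) is called homogenous if $\|T(\lambda x)\|=|\lambda|\,\|Tx\|$ for all $x\in X$, $\lambda\in\mathbb{K}$, and it is called bounded if $\sup\{\|Tx\|:x\in X,\ \|x\|\leq 1\}$ is finite. For a bounded homogenous map $T$ this supremum is denoted by $\|T\|$. Here $\mathbb{N}=\{1,2,3,\dots\}$. *)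

theory Defs
  imports Complex_Main "HOL-Library.Extended_Real" "HOL-Analysis.Abstract_Topology"
    "HOL-Analysis.Abstract_Limits"
begin

text \<open>
  The scalar field is a type \<open>'k\<close> of class \<open>real_normed_field\<close>. By the Gelfand-Mazur theorem
  (the norm of that class is multiplicative) such a field is, up to an isometric isomorphism,
  either \<open>real\<close> or \<open>complex\<close>, and both are instances.

  A quasi-normed space is a linear subspace \<open>S\<close> of an ambient vector space together with
  a function \<open>q\<close> whose values matter on \<open>S\<close> only. The carrier \<open>S\<close> allows a family of different
  quasi-normed spaces to be stated over one type; this loses no generality, since any family of
  vector spaces embeds into its direct sum.
\<close>

locale quasi_normed_space = vector_space scale
  for scale :: "'k::real_normed_field \<Rightarrow> 'a::ab_group_add \<Rightarrow> 'a" +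
  fixes S :: "'a set" and q :: "'a \<Rightarrow> real"
  assumes subspace_carrier: "subspace S"
    and qnorm_nonneg: "x \<in> S \<Longrightarrow> 0 \<le> q x"
    and qnorm_eq_0_imp: "x \<in> S \<Longrightarrow> q x = 0 \<Longrightarrow> x = 0"
    and qnorm_scale: "x \<in> S \<Longrightarrow> q (scale a x) = norm a * q x"
    and qnorm_quasi_triangle:
      "\<exists>K\<ge>1. \<forall>x\<in>S. \<forall>y\<in>S. q (x + y) \<le> K * (q x + q y)"

definition qnorm_topology :: "('a::ab_group_add \<Rightarrow> real) \<Rightarrow> 'a topology" where
  "qnorm_topology q = topology (\<lambda>U. \<forall>x\<in>U. \<exists>\<epsilon>>0. {y. q (x - y) < \<epsilon>} \<subseteq> U)"

lemma istopology_qnorm: "istopology (\<lambda>U. \<forall>x\<in>U. \<exists>\<epsilon>>0. {y. q (x - y) < (\<epsilon>::real)} \<subseteq> U)"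
  unfolding istopology_def
proof (intro conjI allI impI ballI)
  fix U V x
  assume "\<forall>x\<in>U. \<exists>\<epsilon>>0. {y. q (x - y) < \<epsilon>} \<subseteq> U" "\<forall>x\<in>V. \<exists>\<epsilon>>0. {y. q (x - y) < \<epsilon>} \<subseteq> V"
    and "x \<in> U \<inter> V"
  then obtain d e where "d > 0" "{y. q (x - y) < d} \<subseteq> U" "e > 0" "{y. q (x - y) < e} \<subseteq> V"
    by blast
  then show "\<exists>\<epsilon>>0. {y. q (x - y) < \<epsilon>} \<subseteq> U \<inter> V"
    by (intro exI[of _ "min d e"]) auto
next
  fix \<U> x
  assume \<U>: "\<forall>U\<in>\<U>. \<forall>x\<in>U. \<exists>\<epsilon>>0. {y. q (x - y) < \<epsilon>} \<subseteq> U" and "x \<in> \<Union>\<U>"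
  then obtain U where "U \<in> \<U>" "x \<in> U" by blast
  with \<U> obtain e where "e > 0" "{y. q (x - y) < e} \<subseteq> U" by blast
  with \<open>U \<in> \<U>\<close> show "\<exists>\<epsilon>>0. {y. q (x - y) < \<epsilon>} \<subseteq> \<Union>\<U>" by blast
qed

lemma openin_qnorm_topology:
  "openin (qnorm_topology q) U \<longleftrightarrow> (\<forall>x\<in>U. \<exists>\<epsilon>>0. {y. q (x - y) < \<epsilon>} \<subseteq> U)"
  by (simp add: qnorm_topology_def topology_inverse'[OF istopology_qnorm])

text \<open>
  Completeness of a group topology in the sense of topological vector spaces: every Cauchy filter
  (for the translation-invariant uniformity) converges. For a metrizable topology this agrees with
  completeness of any translation-invariant metric inducing it.
\<close>

definition cauchy_filter_on :: "'a::ab_group_add topology \<Rightarrow> 'a filter \<Rightarrow> bool" where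
  "cauchy_filter_on \<tau> F \<longleftrightarrow>
     (\<forall>U. openin \<tau> U \<and> 0 \<in> U \<longrightarrow> (\<forall>\<^sub>F (x, y) in F \<times>\<^sub>F F. x - y \<in> U))"

definition complete_linear_topology :: "'a::ab_group_add topology \<Rightarrow> bool" where
  "complete_linear_topology \<tau> \<longleftrightarrow>
     (\<forall>F. F \<noteq> bot \<and> cauchy_filter_on \<tau> F \<longrightarrow> (\<exists>l. limitin \<tau> (\<lambda>x. x) l F))"

locale quasi_banach_space = quasi_normed_space scale UNIV q
  for scale :: "'k::real_normed_field \<Rightarrow> 'a::ab_group_add \<Rightarrow> 'a" and q :: "'a \<Rightarrow> real" +
  assumes complete: "complete_linear_topology (qnorm_topology q)"

text \<open>
  Below, \<open>p\<close> and \<open>q\<close> are the quasi-norms of the domain and of the codomain. The domain is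
  always a whole type.
\<close>

definition homogenous_map ::
  "('k::real_normed_field \<Rightarrow> 'a \<Rightarrow> 'a) \<Rightarrow> ('b \<Rightarrow> real) \<Rightarrow> ('a \<Rightarrow> 'b) \<Rightarrow> bool" where
  "homogenous_map scale q T \<longleftrightarrow> (\<forall>a x. q (T (scale a x)) = norm a * q (T x))"

definition bounded_map :: "('a \<Rightarrow> real) \<Rightarrow> ('b \<Rightarrow> real) \<Rightarrow> ('a \<Rightarrow> 'b) \<Rightarrow> bool" where
  "bounded_map p q T \<longleftrightarrow> bdd_above ((\<lambda>x. q (T x)) ` {x. p x \<le> 1})"

definition op_qnorm :: "('a \<Rightarrow> real) \<Rightarrow> ('b \<Rightarrow> real) \<Rightarrow> ('a \<Rightarrow> 'b) \<Rightarrow> real" where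
  "op_qnorm p q T = (SUP x\<in>{x. p x \<le> 1}. q (T x))"

end

(* Gliding hump: x is the limit of a sequence S j, where S (j + 1) arises from S j by a small
   correction after which some operator of column m j is large at S (j + 1). Condition (iii) provides
   the correction, unless that column is already unbounded at S j, in which case none is needed.
   Later corrections are small relative to the norm of the operator just chosen, so condition (i),
   applied at the limit x and not at S j, transfers the largeness to x. The term f is thus
   evaluated at the single point x, and (ii) bounds it uniformly in all columns, so every column can be
   visited infinitely often. *)

theory Submission
  imports Defs
begin

section \<open>Convergence of sequences in quasi-Banach spaces\<close>

lemma (in quasi_normed_space) qnorm_minus:
  assumes "x \<in> S"
  shows "q (- x) = q x"
  using qnorm_scale[OF assms, of "- 1"] by (simp add: scale_minus_left)

lemma (in quasi_normed_space) qnorm_zero: "q 0 = 0"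
  using qnorm_scale[OF subspace_0[OF subspace_carrier], of 0] by simp

text \<open>Brings the filter form of completeness down to sequences: the filter of tails of
  \<open>s\<close> is Cauchy for the topology, and its topological limit is turned back into an
  estimate in \<open>q\<close>.\<close>

lemma (in quasi_banach_space) qnorm_Cauchy_converges:
  fixes s :: "nat \<Rightarrow> 'a"
  assumes Cauchy: "\<And>e. e > 0 \<Longrightarrow> \<exists>N. \<forall>m\<ge>N. \<forall>n\<ge>N. q (s m - s n) < e"
  shows "\<exists>l. \<forall>e>0. \<forall>\<^sub>F n in sequentially. q (l - s n) < e"
proof -
  obtain K where K: "K \<ge> 1" "\<And>x y. q (x + y) \<le> K * (q x + q y)"
    using qnorm_quasi_triangle by auto
  let ?F = "filtermap s sequentially"
  have "cauchy_filter_on (qnorm_topology q) ?F"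
    unfolding cauchy_filter_on_def
  proof (intro allI impI)
    fix U assume "openin (qnorm_topology q) U \<and> 0 \<in> U"
    then obtain e where e: "e > 0" "{y. q (0 - y) < e} \<subseteq> U"
      unfolding openin_qnorm_topology by blast
    obtain N where N: "\<forall>m\<ge>N. \<forall>n\<ge>N. q (s m - s n) < e"
      using Cauchy[OF e(1)] by blast
    have U: "s m - s n \<in> U" if "m \<ge> N" "n \<ge> N" for m n
      using N that e(2) qnorm_minus[of "s m - s n"] by auto
    have ev: "\<forall>\<^sub>F x in ?F. x \<in> s ` {N..}"
      unfolding eventually_filtermap by (rule eventually_sequentiallyI[of N]) auto
    show "\<forall>\<^sub>F (x, y) in ?F \<times>\<^sub>F ?F. x - y \<in> U"
      unfolding eventually_prod_filter
      by (rule exI[of _ "\<lambda>x. x \<in> s ` {N..}"], rule exI[of _ "\<lambda>x. x \<in> s ` {N..}"])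
        (use ev U in auto)
  qed
  moreover have "?F \<noteq> bot" by (simp add: filtermap_bot_iff)
  ultimately obtain l where l: "limitin (qnorm_topology q) (\<lambda>x. x) l ?F"
    using complete unfolding complete_linear_topology_def by blast
  have "\<forall>\<^sub>F n in sequentially. q (l - s n) < e" if "e > 0" for e
  proof -
    text \<open>A ball of a quasi-norm need not be open; its interior contains the center.\<close>
    define V where "V = {x. \<exists>d>0. {y. q (x - y) < d} \<subseteq> {y. q (l - y) < e}}"
    have "openin (qnorm_topology q) V"
      unfolding openin_qnorm_topology
    proof
      fix x assume "x \<in> V"
      then obtain d where d: "d > 0" "{y. q (x - y) < d} \<subseteq> {y. q (l - y) < e}"
        unfolding V_def by blast
      \<comment> \<open>Two displacements shorter than \<open>d / (2 * K)\<close> add up to less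
        than \<open>d\<close> despite the factor \<open>K\<close>, so this radius keeps a whole
        quasi-ball around \<open>x\<close> inside \<open>V\<close>.\<close>
      have pos: "d / (2 * K) > 0" using d K by simp
      have "y \<in> V" if y: "q (x - y) < d / (2 * K)" for y
      proof -
        have "q (l - z) < e" if z: "q (y - z) < d / (2 * K)" for z
        proof -
          have "q (x - z) \<le> K * (q (x - y) + q (y - z))"
            using K(2)[of "x - y" "y - z"] by simp
          also have "\<dots> < K * (d / (2 * K) + d / (2 * K))"
            using y z K by (intro mult_strict_left_mono) auto
          also have "\<dots> = d" using K by simp
          finally show ?thesis using d by blast
        qed
        then show ?thesis unfolding V_def using pos by blast
      qed
      then show "\<exists>\<epsilon>>0. {y. q (x - y) < \<epsilon>} \<subseteq> V" using pos by blast
    qed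
    moreover have "l \<in> V" unfolding V_def using that by blast
    ultimately have "\<forall>\<^sub>F n in sequentially. s n \<in> V"
      using l unfolding limitin_def eventually_filtermap by blast
    moreover have "q (l - x) < e" if "x \<in> V" for x
    proof -
      obtain d where "d > 0" "{y. q (x - y) < d} \<subseteq> {y. q (l - y) < e}"
        using \<open>x \<in> V\<close> unfolding V_def by blast
      moreover from this have "x \<in> {y. q (x - y) < d}" using qnorm_zero by simp
      ultimately show ?thesis by blast
    qed
    ultimately show ?thesis by (auto elim: eventually_mono)
  qed
  then show ?thesis by blast
qed

text \<open>In a quasi-norm, summing many steps could cost a power of \<open>K\<close>. Here each
  bound \<open>d k\<close> shrinks by \<open>2 * K\<close>, which pays for that factor and still
  leaves a convergent geometric series.\<close>

lemma (in quasi_banach_space) geometric_steps_converge: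
  fixes s :: "nat \<Rightarrow> 'a" and d :: "nat \<Rightarrow> real"
  assumes K: "K \<ge> 1" "\<And>x y. q (x + y) \<le> K * (q x + q y)"
    and d_pos: "\<And>k. d k > 0"
    and d_Suc: "\<And>k. d (Suc k) \<le> d k / (2 * K)"
    and step: "\<And>k. q (s (Suc k) - s k) \<le> d k"
  shows "\<exists>x. \<forall>j. q (s j - x) \<le> 3 * K\<^sup>2 * d j"
proof -
  \<comment> \<open>The induction splits off the first step and keeps \<open>j\<close> general. The
    remainder starts at \<open>Suc j\<close> and is bounded by
    \<open>2 * K * d (Suc j) \<le> d j\<close>, so the constant does not grow with
    \<open>k\<close>.\<close>
  have tail: "q (s (j + k) - s j) \<le> 2 * K * d j" for j k
  proof (induction k arbitrary: j)
    case 0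
    show ?case using K(1) d_pos[of j] qnorm_zero by simp
  next
    case (Suc k)
    have "q (s (j + Suc k) - s j) \<le> K * (q (s (Suc j) - s j) + q (s (Suc j + k) - s (Suc j)))"
      using K(2)[of "s (Suc j) - s j" "s (Suc j + k) - s (Suc j)"] by simp
    also have "\<dots> \<le> K * (d j + 2 * K * d (Suc j))"
      using step[of j] Suc.IH[of "Suc j"] K(1) by (intro mult_left_mono add_mono) auto
    also have "\<dots> \<le> K * (d j + d j)"
      using d_Suc[of j] K(1) by (intro mult_left_mono add_mono) (auto simp: field_simps)
    finally show ?case by simp
  qed
  have d_le: "d k \<le> d 0 * (1 / 2) ^ k" for k
  proof (induction k)
    case (Suc k)
    have "d (Suc k) \<le> d k / 2"
      using d_Suc[of k] d_pos[of k] K(1) divide_left_mono[of 2 "2 * K" "d k"] by simp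
    with Suc show ?case by simp
  qed simp
  have "d \<longlonglongrightarrow> 0"
  proof (rule tendsto_sandwich[OF _ _ tendsto_const])
    show "(\<lambda>k. d 0 * (1 / 2) ^ k) \<longlonglongrightarrow> 0"
      by (intro tendsto_mult_right_zero LIMSEQ_power_zero) simp
  qed (use d_le d_pos in \<open>auto intro!: always_eventually less_imp_le\<close>)
  have "\<exists>N. \<forall>m\<ge>N. \<forall>n\<ge>N. q (s m - s n) < e" if "e > 0" for e
  proof -
    have "e / (4 * K\<^sup>2) > 0" using that K(1) by simp
    with \<open>d \<longlonglongrightarrow> 0\<close> have "\<forall>\<^sub>F k in sequentially. d k < e / (4 * K\<^sup>2)"
      by (rule order_tendstoD)
    then obtain N where N: "d N < e / (4 * K\<^sup>2)"
      unfolding eventually_sequentially by blast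
    have "q (s m - s n) < e" if "m \<ge> N" "n \<ge> N" for m n
    proof -
      have "q (s m - s n) \<le> K * (q (s m - s N) + q (s n - s N))"
        using K(2)[of "s m - s N" "s N - s n"] qnorm_minus[of "s n - s N"] by simp
      also have "\<dots> \<le> K * (2 * K * d N + 2 * K * d N)"
        using tail[of N "m - N"] tail[of N "n - N"] that K(1)
        by (intro mult_left_mono add_mono) auto
      also have "\<dots> < e" using N K(1) by (simp add: field_simps power2_eq_square)
      finally show ?thesis .
    qed
    then show ?thesis by blast
  qed
  then obtain x where x: "\<forall>e>0. \<forall>\<^sub>F n in sequentially. q (x - s n) < e"
    using qnorm_Cauchy_converges[of s] by blast
  have "q (s j - x) \<le> 3 * K\<^sup>2 * d j" for j
  proof -
    \<comment> \<open>A quasi-norm may be discontinuous, so \<open>tail\<close> cannot simply be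
      passed to the limit. One late \<open>s n\<close> serves as an intermediate point, at the price
      of another factor \<open>K\<close>.\<close>
    have "\<forall>\<^sub>F n in sequentially. q (x - s n) < d j \<and> n \<ge> j"
      using x d_pos by (intro eventually_conj eventually_ge_at_top) auto
    then obtain n where n: "q (x - s n) < d j" "n \<ge> j"
      unfolding eventually_sequentially by blast
    have "q (s j - x) \<le> K * (q (s n - s j) + q (x - s n))"
      using K(2)[of "s j - s n" "s n - x"] qnorm_minus[of "s n - s j"] qnorm_minus[of "x - s n"]
      by simp
    also have "\<dots> \<le> K * (2 * K * d j + K * d j)"
    proof (intro mult_left_mono add_mono)
      show "q (s n - s j) \<le> 2 * K * d j" using tail[of j "n - j"] n by simp
      show "q (x - s n) \<le> K * d j"
        using d_pos[of j] K(1) by (intro order_trans[OF less_imp_le[OF n(1)]]) simp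
    qed (use K(1) in simp)
    finally show ?thesis by (simp add: power2_eq_square algebra_simps)
  qed
  then show ?thesis by blast
qed

section \<open>Unboundedness of a column of operators near a point\<close>

text \<open>Finitely many real terms cannot make a supremum infinite. The frequency form allows the
  index of a large term to be taken beyond any prescribed bound.\<close>

lemma SUP_ereal_eq_PInfty_iff_frequently:
  fixes a :: "nat \<Rightarrow> real"
  shows "(SUP n\<in>{k..}. ereal (a n)) = \<infinity> \<longleftrightarrow> (\<forall>B. \<exists>\<^sub>F n in sequentially. B < a n)"
proof
  assume sup: "(SUP n\<in>{k..}. ereal (a n)) = \<infinity>"
  show "\<forall>B. \<exists>\<^sub>F n in sequentially. B < a n"
  proof (rule ccontr)
    assume "\<not> ?thesis"
    then obtain B M where B: "\<And>n. n \<ge> M \<Longrightarrow> a n \<le> B"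
      by (auto simp: not_frequently eventually_sequentially not_less)
    define D where "D = Max (insert B (a ` {..M}))"
    have "a n \<le> D" for n
    proof (cases "n \<le> M")
      case True
      then show ?thesis unfolding D_def by (intro Max_ge) auto
    next
      case False
      then have "a n \<le> B" by (intro B) simp
      also have "B \<le> D" unfolding D_def by (intro Max_ge) auto
      finally show ?thesis .
    qed
    then have "(SUP n\<in>{k..}. ereal (a n)) \<le> ereal D" by (intro SUP_least) simp
    with sup show False by simp
  qed
next
  assume freq: "\<forall>B. \<exists>\<^sub>F n in sequentially. B < a n"
  show "(SUP n\<in>{k..}. ereal (a n)) = \<infinity>"
  proof (rule SUP_PInfty)
    fix j :: nat
    obtain n where "n \<ge> k" "real j < a n"
      using freq unfolding frequently_sequentially by blast
    then show "\<exists>n\<in>{k..}. ereal (real j) \<le> ereal (a n)" by (intro bexI[of _ n]) auto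
  qed
qed

text \<open>A vector of the unit ball that attains more than half of the operator quasi-norm is
  rescaled by \<open>d\<close>; homogeneity carries the estimate along.\<close>

lemma (in quasi_normed_space) almost_norming_vector:
  assumes "S = UNIV" and "homogenous_map scale r T" and "bounded_map q r T"
    and "0 < op_qnorm q r T" and "0 < d"
  shows "\<exists>y. q y \<le> d \<and> d * op_qnorm q r T / 2 < r (T y)"
proof -
  have "op_qnorm q r T / 2 < op_qnorm q r T" using assms by simp
  moreover have "0 \<in> {x. q x \<le> 1}" using qnorm_zero by simp
  ultimately obtain x where x: "q x \<le> 1" "op_qnorm q r T / 2 < r (T x)"
    using less_cSUP_iff[of "{x. q x \<le> 1}" "\<lambda>x. r (T x)" "op_qnorm q r T / 2"] assms(3)
    unfolding op_qnorm_def[symmetric] bounded_map_def by blast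
  let ?y = "scale (of_real d) x"
  have "q ?y \<le> d"
    using qnorm_scale[of x] x(1) assms by (simp add: mult_left_le)
  moreover have "r (T ?y) = d * r (T x)"
    using assms unfolding homogenous_map_def by simp
  ultimately show ?thesis using x(2) \<open>0 < d\<close> by (intro exI[of _ ?y]) simp
qed

text \<open>Existence of one hump. If the column is already unbounded at \<open>x\<close>, then
  \<open>y = 0\<close> serves. Otherwise its values at \<open>x\<close> are eventually bounded, and
  \<open>lower\<close> with an almost norming \<open>y\<close> forces large values at
  \<open>x + y\<close>.\<close>

lemma (in quasi_normed_space) frequently_large_near:
  fixes r :: "nat \<Rightarrow> 'b \<Rightarrow> real" and T :: "nat \<Rightarrow> 'a \<Rightarrow> 'b"
  assumes UNIV: "S = UNIV"
    and hom: "\<And>n. n \<ge> 1 \<Longrightarrow> homogenous_map scale (r n) (T n)"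
    and bdd: "\<And>n. n \<ge> 1 \<Longrightarrow> bounded_map q (r n) (T n)"
    and unbounded: "\<And>B. \<exists>\<^sub>F n in sequentially. B < op_qnorm q (r n) (T n)"
    and "0 < L"
    and lower: "\<And>y n. q y \<le> 1 \<Longrightarrow> n \<ge> 1 \<Longrightarrow>
      r n (T n y) \<le> L * (r n (T n (x + y)) + r n (T n x) + c n * op_qnorm q (r n) (T n))"
    and c: "c \<longlonglongrightarrow> 0"
    and "0 < d"
  shows "\<exists>\<^sub>F n in sequentially. \<exists>y. q y \<le> d \<and> B < r n (T n (x + y))"
proof (cases "\<forall>B. \<exists>\<^sub>F n in sequentially. B < r n (T n x)")
  case True
  then have "\<exists>\<^sub>F n in sequentially. B < r n (T n x)" by blast
  then show ?thesis
    by (rule frequently_elim1) (intro exI[of _ 0], use qnorm_zero \<open>0 < d\<close> in simp)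
next
  case False
  then obtain A where A: "\<forall>\<^sub>F n in sequentially. r n (T n x) \<le> A"
    by (auto simp: not_frequently not_less)
  \<comment> \<open>The cap at 1 makes \<open>lower\<close> applicable to every \<open>y\<close>
    with \<open>q y \<le> \<delta>\<close>.\<close>
  define \<delta> where "\<delta> = min d 1"
  have \<delta>: "0 < \<delta>" "\<delta> \<le> d" "\<delta> \<le> 1" using \<open>0 < d\<close> by (auto simp: \<delta>_def)
  have "0 < \<delta> / (4 * L)" using \<delta> \<open>0 < L\<close> by simp
  with c have "\<forall>\<^sub>F n in sequentially. c n < \<delta> / (4 * L)" by (rule order_tendstoD)
  with A have "\<forall>\<^sub>F n in sequentially. r n (T n x) \<le> A \<and> c n < \<delta> / (4 * L) \<and> n \<ge> 1"
    by (intro eventually_conj eventually_ge_at_top)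
  \<comment> \<open>Of the gain \<open>\<delta> * ?t / 2\<close> at \<open>y\<close>, the term with
    \<open>c n\<close> consumes at most half. The remaining \<open>\<delta> * ?t / 4\<close> must
    exceed \<open>L * (A + B)\<close>, hence the threshold; the 0 in it secures a positive operator
    quasi-norm.\<close>
  then have "\<forall>\<^sub>F n in sequentially. max 0 (4 * L * (A + B) / \<delta>) < op_qnorm q (r n) (T n)
      \<longrightarrow> (\<exists>y. q y \<le> d \<and> B < r n (T n (x + y)))"
  proof (rule eventually_mono, intro impI)
    fix n
    let ?t = "op_qnorm q (r n) (T n)"
    assume n: "r n (T n x) \<le> A \<and> c n < \<delta> / (4 * L) \<and> n \<ge> 1"
      and t: "max 0 (4 * L * (A + B) / \<delta>) < ?t"
    obtain y where y: "q y \<le> \<delta>" "\<delta> * ?t / 2 < r n (T n y)"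
      using almost_norming_vector[OF UNIV hom bdd _ \<delta>(1)] n t by auto
    have "c n * ?t \<le> \<delta> / (4 * L) * ?t" using n t by (intro mult_right_mono) auto
    then have "L * (c n * ?t) \<le> L * (\<delta> / (4 * L) * ?t)"
      using \<open>0 < L\<close> by (intro mult_left_mono) auto
    also have "\<dots> = \<delta> * ?t / 4" using \<open>0 < L\<close> by simp
    finally have ct: "L * (c n * ?t) \<le> \<delta> * ?t / 4" .
    have "L * r n (T n x) \<le> L * A" using n \<open>0 < L\<close> by simp
    moreover have "r n (T n y) \<le> L * (r n (T n (x + y)) + r n (T n x) + c n * ?t)"
      using y \<delta> n by (intro lower) auto
    moreover have "L * (A + B) < \<delta> * ?t / 4" using t \<delta> by (simp add: field_simps)
    ultimately have "L * B < L * r n (T n (x + y))"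
      using y(2) ct by (simp add: algebra_simps)
    then show "\<exists>y. q y \<le> d \<and> B < r n (T n (x + y))"
      using y(1) \<delta>(2) \<open>0 < L\<close> by (intro exI[of _ y]) auto
  qed
  with unbounded show ?thesis by (rule frequently_rev_mp)
qed

section \<open>The gliding hump construction\<close>

theorem mainTheorem1:
  fixes scaleX :: "'k::real_normed_field \<Rightarrow> 'a::ab_group_add \<Rightarrow> 'a"
    and p :: "'a \<Rightarrow> real"
    and scaleY :: "'k \<Rightarrow> 'b::ab_group_add \<Rightarrow> 'b"
    and Y :: "nat \<Rightarrow> nat \<Rightarrow> 'b set"
    and q :: "nat \<Rightarrow> nat \<Rightarrow> 'b \<Rightarrow> real"
    and T :: "nat \<Rightarrow> nat \<Rightarrow> 'a \<Rightarrow> 'b"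
    and C L :: "nat \<Rightarrow> real"
    and N :: "nat \<Rightarrow> nat"
    and c f :: "nat \<Rightarrow> nat \<Rightarrow> 'a \<Rightarrow> real"
  assumes X: "quasi_banach_space scaleX p"
    and Y: "\<And>n m. n \<ge> 1 \<Longrightarrow> m \<ge> 1 \<Longrightarrow> quasi_normed_space scaleY (Y n m) (q n m)"
    and T_maps: "\<And>n m x. n \<ge> 1 \<Longrightarrow> m \<ge> 1 \<Longrightarrow> T n m x \<in> Y n m"
    and T_homogenous: "\<And>n m. n \<ge> 1 \<Longrightarrow> m \<ge> 1 \<Longrightarrow> homogenous_map scaleX (q n m) (T n m)"
    and T_bounded: "\<And>n m. n \<ge> 1 \<Longrightarrow> m \<ge> 1 \<Longrightarrow> bounded_map p (q n m) (T n m)"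
    and T_unbounded:
      "\<And>m. m \<ge> 1 \<Longrightarrow> (SUP n\<in>{1..}. ereal (op_qnorm p (q n m) (T n m))) = \<infinity>"
    and C_pos: "\<And>m. m \<ge> 1 \<Longrightarrow> C m > 0"
    and L_pos: "\<And>m. m \<ge> 1 \<Longrightarrow> L m > 0"
    and N_pos: "\<And>m. m \<ge> 1 \<Longrightarrow> N m \<ge> 1"
    and c_nonneg: "\<And>n m x. n \<ge> 1 \<Longrightarrow> m \<ge> 1 \<Longrightarrow> c n m x \<ge> 0"
    and f_nonneg: "\<And>n m x. n \<ge> 1 \<Longrightarrow> m \<ge> 1 \<Longrightarrow> f n m x \<ge> 0"
    and i: "\<And>x y n m. p y \<le> 1 \<Longrightarrow> n \<ge> 1 \<Longrightarrow> m \<ge> 1 \<Longrightarrow> n \<ge> N m \<Longrightarrow>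
      q n m (T n m (x + y))
        \<le> C m * (q n m (T n m x) + op_qnorm p (q n m) (T n m) * p y + f n m x)"
    and ii: "\<And>x. \<exists>M\<ge>0. \<exists>n0\<ge>1. \<forall>n\<ge>n0. \<forall>m\<ge>1. f n m x \<le> M"
    and iii: "\<And>x y n m. p y \<le> 1 \<Longrightarrow> n \<ge> 1 \<Longrightarrow> m \<ge> 1 \<Longrightarrow>
      q n m (T n m y)
        \<le> L m * (q n m (T n m (x + y)) + q n m (T n m x)
                  + c n m x * op_qnorm p (q n m) (T n m))"
    and iv: "\<And>x m. m \<ge> 1 \<Longrightarrow> (\<lambda>n. c n m x) \<longlonglongrightarrow> 0"
  shows "\<exists>x. \<forall>m\<ge>1. (SUP n\<in>{1..}. ereal (q n m (T n m x))) = \<infinity>"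
proof -
  interpret quasi_banach_space scaleX p by (fact X)
  obtain K where K: "K \<ge> 1" "\<And>x y. p (x + y) \<le> K * (p x + p y)"
    using qnorm_quasi_triangle by auto
  define t where "t n m = op_qnorm p (q n m) (T n m)" for n m
  \<comment> \<open>The pairing function makes every column from 1 on occur for infinitely many
    \<open>j\<close>.\<close>
  define col where "col j = Suc (fst (prod_decode j))" for j
  \<comment> \<open>The factor \<open>C (col j)\<close> will cancel the constant of (i);
    \<open>n \<ge> j\<close> sends the chosen operator indices to infinity.\<close>
  define hump where "hump j s d n s' \<longleftrightarrow>
      p (s' - s) \<le> d \<and> n \<ge> j \<and> n \<ge> N (col j) \<and> n \<ge> 1
      \<and> C (col j) * real j < q n (col j) (T n (col j) s')" for j s d n s'
  have hump_exists: "\<exists>n s'. hump j s d n s'" if "d > 0" for j s d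
  proof -
    have m: "col j \<ge> 1" by (simp add: col_def)
    have "\<exists>\<^sub>F n in sequentially. \<exists>y. p y \<le> d \<and>
        C (col j) * real j < q n (col j) (T n (col j) (s + y))"
      by (rule frequently_large_near[where L = "L (col j)" and c = "\<lambda>n. c n (col j) s"])
        (use T_homogenous T_bounded T_unbounded L_pos iii iv that m in
          \<open>simp_all add: SUP_ereal_eq_PInfty_iff_frequently\<close>)
    then obtain n y where "n \<ge> max (max j (N (col j))) 1" "p y \<le> d"
        "C (col j) * real j < q n (col j) (T n (col j) (s + y))"
      unfolding frequently_sequentially by blast
    then show ?thesis
      unfolding hump_def by (intro exI[of _ n] exI[of _ "s + y"]) simp
  qed
  \<comment> \<open>The first bound gives the geometric decay. The second cancels the
    \<open>3 * K\<^sup>2\<close> of \<open>geometric_steps_converge\<close>, leaving a distance to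
    the limit that is at most 1, also after multiplication by \<open>t n (col j)\<close>.\<close>
  define shrink where "shrink j d n = min (d / (2 * K)) (1 / (3 * K\<^sup>2 * max 1 (t n (col j))))"
    for j d n
  \<comment> \<open>A state holds the current point, the size allowed for the next correction, and
    the operator index of the preceding hump. The index of hump \<open>j\<close> is therefore stored
    in state \<open>Suc j\<close>.\<close>
  have "\<exists>\<sigma> :: nat \<Rightarrow> 'a \<times> real \<times> nat. \<forall>j. 0 < fst (snd (\<sigma> j)) \<and>
      hump j (fst (\<sigma> j)) (fst (snd (\<sigma> j))) (snd (snd (\<sigma> (Suc j)))) (fst (\<sigma> (Suc j))) \<and>
      fst (snd (\<sigma> (Suc j))) = shrink j (fst (snd (\<sigma> j))) (snd (snd (\<sigma> (Suc j))))"
  proof (rule dependent_nat_choice)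
    show "\<exists>u :: 'a \<times> real \<times> nat. 0 < fst (snd u)"
      by (intro exI[of _ "(0, 1, 0)"]) simp
  next
    fix u :: "'a \<times> real \<times> nat" and j
    assume u: "0 < fst (snd u)"
    then obtain n s' where "hump j (fst u) (fst (snd u)) n s'" using hump_exists by blast
    moreover have "0 < shrink j (fst (snd u)) n" using u K(1) by (simp add: shrink_def)
    ultimately show "\<exists>u' :: 'a \<times> real \<times> nat. 0 < fst (snd u') \<and>
        hump j (fst u) (fst (snd u)) (snd (snd u')) (fst u') \<and>
        fst (snd u') = shrink j (fst (snd u)) (snd (snd u'))"
      by (intro exI[of _ "(s', shrink j (fst (snd u)) n, n)"]) simp
  qed
  then obtain \<sigma> :: "nat \<Rightarrow> 'a \<times> real \<times> nat" where \<sigma>: "\<And>j. 0 < fst (snd (\<sigma> j))"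
    "\<And>j. hump j (fst (\<sigma> j)) (fst (snd (\<sigma> j))) (snd (snd (\<sigma> (Suc j)))) (fst (\<sigma> (Suc j)))"
    "\<And>j. fst (snd (\<sigma> (Suc j))) = shrink j (fst (snd (\<sigma> j))) (snd (snd (\<sigma> (Suc j))))"
    by blast
  define s where "s j = fst (\<sigma> j)" for j
  define d where "d j = fst (snd (\<sigma> j))" for j
  define \<nu> where "\<nu> j = snd (snd (\<sigma> (Suc j)))" for j
  have d_pos: "d j > 0" and hump: "hump j (s j) (d j) (\<nu> j) (s (Suc j))"
    and d_Suc: "d (Suc j) = shrink j (d j) (\<nu> j)" for j
    using \<sigma>[of j] by (simp_all add: s_def d_def \<nu>_def)
  obtain x where x: "\<And>j. p (s j - x) \<le> 3 * K\<^sup>2 * d j"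
    using geometric_steps_converge[OF K, of d s] d_pos hump
    by (auto simp: hump_def d_Suc shrink_def)
  obtain M n0 where M: "\<And>n m. n \<ge> n0 \<Longrightarrow> m \<ge> 1 \<Longrightarrow> f n m x \<le> M"
    using ii[of x] by blast
  have large: "real j - 1 - M < q (\<nu> j) (col j) (T (\<nu> j) (col j) x)" if "j \<ge> n0" for j
  proof -
    let ?m = "col j" and ?n = "\<nu> j" and ?y = "s (Suc j) - x"
    have m: "?m \<ge> 1" by (simp add: col_def)
    have n: "?n \<ge> 1" "?n \<ge> N ?m" "?n \<ge> n0" and big: "C ?m * real j < q ?n ?m (T ?n ?m (s (Suc j)))"
      using hump[of j] that by (auto simp: hump_def)
    have "d (Suc j) \<le> 1 / (3 * K\<^sup>2 * max 1 (t ?n ?m))" by (simp add: d_Suc shrink_def)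
    then have "3 * K\<^sup>2 * d (Suc j) * max 1 (t ?n ?m) \<le> 1"
      using K(1) by (simp add: field_simps)
    moreover have "p ?y * max 1 (t ?n ?m) \<le> 3 * K\<^sup>2 * d (Suc j) * max 1 (t ?n ?m)"
      using x[of "Suc j"] by (intro mult_right_mono) auto
    ultimately have y: "p ?y * max 1 (t ?n ?m) \<le> 1" by linarith
    have "p ?y * 1 \<le> p ?y * max 1 (t ?n ?m)" "p ?y * t ?n ?m \<le> p ?y * max 1 (t ?n ?m)"
      using qnorm_nonneg[of ?y] by (intro mult_left_mono; simp)+
    with y have y1: "p ?y \<le> 1" and ty: "p ?y * t ?n ?m \<le> 1" by - linarith+
    \<comment> \<open>Condition (i) has base point \<open>x\<close> and perturbation
      \<open>?y\<close>, whose sum is \<open>s (Suc j)\<close>. The two error terms then cost at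
      most \<open>1 + M\<close>, with the same \<open>M\<close> for all columns.\<close>
    have "C ?m * real j < C ?m * (q ?n ?m (T ?n ?m x) + p ?y * t ?n ?m + f ?n ?m x)"
      using big i[OF y1 n(1) m n(2), of x] by (simp add: t_def mult.commute)
    then have "real j < q ?n ?m (T ?n ?m x) + p ?y * t ?n ?m + f ?n ?m x"
      using C_pos[OF m] by simp
    with ty M[OF n(3) m] show ?thesis by linarith
  qed
  have "\<exists>\<^sub>F n in sequentially. B < q n m (T n m x)" if "m \<ge> 1" for m B
    unfolding frequently_sequentially
  proof
    fix k
    \<comment> \<open>Since \<open>prod_encode (m - 1, b)\<close> is at least \<open>b\<close>, this
      choice yields a visit to column \<open>m\<close> that is late enough for \<open>k\<close>, for
      \<open>n0\<close> and for the bound in \<open>large\<close> to reach \<open>B\<close>.\<close>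
    define b where "b = max (max k n0) (nat \<lceil>B + 1 + M\<rceil>)"
    define j where "j = prod_encode (m - 1, b)"
    have "col j = m" using that by (simp add: col_def j_def)
    have "j \<ge> b" unfolding j_def by (rule le_prod_encode_2)
    then have "j \<ge> k" "j \<ge> n0" "real j \<ge> B + 1 + M" unfolding b_def by linarith+
    with large[of j] hump[of j] \<open>col j = m\<close> show "\<exists>n\<ge>k. B < q n m (T n m x)"
      by (intro exI[of _ "\<nu> j"]) (auto simp: hump_def)
  qed
  then show ?thesis by (auto simp: SUP_ereal_eq_PInfty_iff_frequently)
qed

end
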